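(* Let $\mathbb{L}$ be a regular pseudocomplemented Kleene algebra. Then there exist a set $U$ and a tolerance $R$ on $U$ induced by an irredundant covering of $U$ such that $\mathbb{L}$ is isomorphic to a subalgebra of the rough set algebra $\mathbb{RS}=(\mathit{RS},\vee,\wedge,{\sim},{^*},(\emptyset,\emptyset),(U,U))$ determined by $R$.
   Context: A pseudocomplemented Kleene algebra is an algebra $(L,\vee,\wedge,{\sim},{^*},0,1)$ such that $(L,\vee,\wedge,0,1)$ is a bounded distributive lattice, ${\sim}$ satisfies ${\sim}{\sim}x=x$, $x\leq y\Rightarrow {\sim}x\geq{\sim}y$, and $x\wedge{\sim}x\leq y\vee{\sim}y$, and $x^*$ is the pseudocomplement of $x$. It is regular if for all $x,y$: $x^*=y^*$ and $({\sim}x)^*=({\sim}y)^*$ imply $x=y$. A covering of $U$ is a family $\mathcal{H}$ of nonempty subsets of $U$ with $\bigcup\mathcal{H}=U$; it is irredundant if $\mathcal{H}\setminus\{X\}$ is not a covering for any $X\in\mathcal{H}$; the tolerance induced by $\mathcal{H}$ is $R=\bigcup\{X\times X\mid X\in\mathcal{H}\}$. For a binary relation $R$ on $U$, write $R(x)=\{y\mid x\,R\,y\}$, and for $X\subseteq U$ let $X^\blacktriangledown=\{x\mid R(x)\subseteq X\}$, $X^\blacktriangle=\{x\mid R(x)\cap X\neq\emptyset\}$, and $X^c=U\setminus X$. The set of rough sets is $\mathit{RS}=\{(X^\blacktriangledown,X^\blacktriangle)\mid X\subseteq U\}$, with operations $(X^\blacktriangledown,X^\blacktriangle)\vee(Y^\blacktriangledown,Y^\blacktriangle)=((X^\blacktriangledown\cup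 Y^\blacktriangledown)^{\blacktriangle\blacktriangledown},X^\blacktriangle\cup Y^\blacktriangle)$, $(X^\blacktriangledown,X^\blacktriangle)\wedge(Y^\blacktriangledown,Y^\blacktriangle)=(X^\blacktriangledown\cap Y^\blacktriangledown,(X^\blacktriangle\cap Y^\blacktriangle)^{\blacktriangledown\blacktriangle})$, ${\sim}(X^\blacktriangledown,X^\blacktriangle)=(X^{c\blacktriangledown},X^{c\blacktriangle})$, $(X^\blacktriangledown,X^\blacktriangle)^*=(X^{c\blacktriangledown\blacktriangledown},X^{c\blacktriangledown\blacktriangle})$. When $R$ is a tolerance induced by an irredundant covering, this is a regular pseudocomplemented Kleene algebra. *)

theory Defs imports Main begin

locale pseudocomplemented_kleene_algebra =
  fixes neg star :: "'a::{distrib_lattice, bounded_lattice} \<Rightarrow> 'a"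
  assumes neg_neg: "neg (neg x) = x"
    and neg_antimono: "x \<le> y \<Longrightarrow> neg y \<le> neg x"
    and kleene: "inf x (neg x) \<le> sup y (neg y)"
    and inf_star: "inf x (star x) = bot"
    and star_greatest: "inf x y = bot \<Longrightarrow> y \<le> star x"

locale regular_pseudocomplemented_kleene_algebra = pseudocomplemented_kleene_algebra +
  assumes regular: "star x = star y \<Longrightarrow> star (neg x) = star (neg y) \<Longrightarrow> x = y"

definition covering :: "'u set \<Rightarrow> 'u set set \<Rightarrow> bool" where
  "covering U H \<longleftrightarrow> (\<forall>X\<in>H. X \<noteq> {} \<and> X \<subseteq> U) \<and> \<Union>H = U"

definition irredundant_covering :: "'u set \<Rightarrow> 'u set set \<Rightarrow> bool" where
  "irredundant_covering U H \<longleftrightarrow> covering U H \<and> (\<forall>X\<in>H. \<not> covering U (H - {X}))"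

definition induced_tolerance :: "'u set set \<Rightarrow> ('u \<times> 'u) set" where
  "induced_tolerance H = (\<Union>X\<in>H. X \<times> X)"

definition lower :: "'u set \<Rightarrow> ('u \<times> 'u) set \<Rightarrow> 'u set \<Rightarrow> 'u set" where
  "lower U R X = {x \<in> U. R `` {x} \<subseteq> X}"

definition upper :: "'u set \<Rightarrow> ('u \<times> 'u) set \<Rightarrow> 'u set \<Rightarrow> 'u set" where
  "upper U R X = {x \<in> U. R `` {x} \<inter> X \<noteq> {}}"

definition rough_set :: "'u set \<Rightarrow> ('u \<times> 'u) set \<Rightarrow> 'u set \<Rightarrow> 'u set \<times> 'u set" where
  "rough_set U R X = (lower U R X, upper U R X)"

definition RS :: "'u set \<Rightarrow> ('u \<times> 'u) set \<Rightarrow> ('u set \<times> 'u set) set" where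
  "RS U R = rough_set U R ` Pow U"

definition rs_join ::
  "'u set \<Rightarrow> ('u \<times> 'u) set \<Rightarrow> 'u set \<times> 'u set \<Rightarrow> 'u set \<times> 'u set \<Rightarrow> 'u set \<times> 'u set" where
  "rs_join U R p q = (lower U R (upper U R (fst p \<union> fst q)), snd p \<union> snd q)"

definition rs_meet ::
  "'u set \<Rightarrow> ('u \<times> 'u) set \<Rightarrow> 'u set \<times> 'u set \<Rightarrow> 'u set \<times> 'u set \<Rightarrow> 'u set \<times> 'u set" where
  "rs_meet U R p q = (fst p \<inter> fst q, upper U R (lower U R (snd p \<inter> snd q)))"

text \<open>Negation and pseudocomplement are specified through a set representing the given rough set.
  The lemmas \<open>rs_neg_rough_set\<close> and \<open>rs_star_rough_set\<close> below show that the result does not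
  depend on the representative when \<open>R \<subseteq> U \<times> U\<close>. Outside \<open>RS U R\<close> the two functions are unspecified.\<close>

definition rs_neg ::
  "'u set \<Rightarrow> ('u \<times> 'u) set \<Rightarrow> 'u set \<times> 'u set \<Rightarrow> 'u set \<times> 'u set" where
  "rs_neg U R p = (THE q. \<exists>X\<subseteq>U. p = rough_set U R X \<and>
     q = (lower U R (U - X), upper U R (U - X)))"

definition rs_star ::
  "'u set \<Rightarrow> ('u \<times> 'u) set \<Rightarrow> 'u set \<times> 'u set \<Rightarrow> 'u set \<times> 'u set" where
  "rs_star U R p = (THE q. \<exists>X\<subseteq>U. p = rough_set U R X \<and>
     q = (lower U R (lower U R (U - X)), upper U R (lower U R (U - X))))"

lemma lower_compl: "R \<subseteq> U \<times> U \<Longrightarrow> lower U R (U - X) = U - upper U R X"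
  unfolding lower_def upper_def by blast

lemma upper_compl: "R \<subseteq> U \<times> U \<Longrightarrow> upper U R (U - X) = U - lower U R X"
  unfolding lower_def upper_def by blast

lemma rs_neg_rough_set:
  assumes "R \<subseteq> U \<times> U" "X \<subseteq> U"
  shows "rs_neg U R (rough_set U R X) = (lower U R (U - X), upper U R (U - X))"
  unfolding rs_neg_def
proof (rule the_equality)
  show "\<exists>Y\<subseteq>U. rough_set U R X = rough_set U R Y \<and>
    (lower U R (U - X), upper U R (U - X)) = (lower U R (U - Y), upper U R (U - Y))"
    using assms(2) by blast
qed (auto simp: rough_set_def lower_compl[OF assms(1)] upper_compl[OF assms(1)])

lemma rs_star_rough_set:
  assumes "R \<subseteq> U \<times> U" "X \<subseteq> U"
  shows "rs_star U R (rough_set U R X) =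
    (lower U R (lower U R (U - X)), upper U R (lower U R (U - X)))"
  unfolding rs_star_def
proof (rule the_equality)
  show "\<exists>Y\<subseteq>U. rough_set U R X = rough_set U R Y \<and>
    (lower U R (lower U R (U - X)), upper U R (lower U R (U - X))) =
    (lower U R (lower U R (U - Y)), upper U R (lower U R (U - Y)))"
    using assms(2) by blast
qed (auto simp: rough_set_def lower_compl[OF assms(1)])

lemma induced_tolerance_subset: "covering U H \<Longrightarrow> induced_tolerance H \<subseteq> U \<times> U"
  unfolding covering_def induced_tolerance_def by blast

definition rs_subalgebra ::
  "'u set \<Rightarrow> ('u \<times> 'u) set \<Rightarrow> ('u set \<times> 'u set) set \<Rightarrow> bool" where
  "rs_subalgebra U R S \<longleftrightarrow> S \<subseteq> RS U R \<and> ({}, {}) \<in> S \<and> (U, U) \<in> S \<and>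
     (\<forall>p\<in>S. \<forall>q\<in>S. rs_join U R p q \<in> S \<and> rs_meet U R p q \<in> S) \<and>
     (\<forall>p\<in>S. rs_neg U R p \<in> S \<and> rs_star U R p \<in> S)"

definition rs_isomorphism ::
  "('a::{distrib_lattice, bounded_lattice} \<Rightarrow> 'a) \<Rightarrow> ('a \<Rightarrow> 'a) \<Rightarrow> 'u set \<Rightarrow> ('u \<times> 'u) set \<Rightarrow>
   ('u set \<times> 'u set) set \<Rightarrow> ('a \<Rightarrow> 'u set \<times> 'u set) \<Rightarrow> bool" where
  "rs_isomorphism neg star U R S h \<longleftrightarrow> bij_betw h UNIV S \<and>
     (\<forall>x y. h (sup x y) = rs_join U R (h x) (h y)) \<and>
     (\<forall>x y. h (inf x y) = rs_meet U R (h x) (h y)) \<and>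
     (\<forall>x. h (neg x) = rs_neg U R (h x)) \<and>
     (\<forall>x. h (star x) = rs_star U R (h x)) \<and>
     h bot = ({}, {}) \<and> h top = (U, U)"

end

theory Submission imports Defs begin

text \<open>Order the prime filters by inclusion. The map \<open>g F = {x. \<sim>x \<notin> F}\<close> is an antitone involution,
  and by the Kleene inequality \<open>F\<close> and \<open>g F\<close> are comparable, so the prime filters are those in
  \<open>P = {F. F \<subseteq> g F}\<close> together with their images under \<open>g\<close>. On \<open>P\<close> the relation \<open>F \<subseteq> g G\<close> is reflexive
  and symmetric. Take as points of \<open>U\<close> the related pairs \<open>{F, G}\<close> in \<open>P\<close>, together with the pairs
  \<open>{F, g F}\<close>, and as block of \<open>F \<in> P\<close> all points containing \<open>F\<close>. The point \<open>{F}\<close> lies in the block of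
  \<open>F\<close> only, so the covering by blocks is irredundant, and an element \<open>x\<close> is sent to the rough set
  whose lower part is determined by the blocks with \<open>x \<in> F\<close> and whose upper part is determined by the
  blocks with \<open>x \<in> g F\<close>. Regularity enters only through the inequality \<open>\<sim>(x \<or> x\<^sup>*) \<le> x \<or> x\<^sup>*\<close>, which says
  that \<open>x\<close> or \<open>x\<^sup>*\<close> belongs to \<open>g F\<close> for every \<open>F \<in> P\<close>.\<close>

section \<open>Prime filters\<close>

definition lattice_filter :: "'a::bounded_lattice set \<Rightarrow> bool" where
  "lattice_filter F \<longleftrightarrow> top \<in> F \<and> (\<forall>x y. x \<in> F \<longrightarrow> x \<le> y \<longrightarrow> y \<in> F) \<and>
     (\<forall>x\<in>F. \<forall>y\<in>F. inf x y \<in> F)"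

definition prime_filter :: "'a::bounded_lattice set \<Rightarrow> bool" where
  "prime_filter F \<longleftrightarrow> lattice_filter F \<and> bot \<notin> F \<and> (\<forall>x y. sup x y \<in> F \<longrightarrow> x \<in> F \<or> y \<in> F)"

lemma lattice_filterD:
  assumes "lattice_filter F"
  shows lattice_filter_top: "top \<in> F"
    and lattice_filter_mono: "x \<in> F \<Longrightarrow> x \<le> y \<Longrightarrow> y \<in> F"
    and lattice_filter_inf: "inf x y \<in> F \<longleftrightarrow> x \<in> F \<and> y \<in> F"
  using assms unfolding lattice_filter_def by (blast, blast, meson inf_le1 inf_le2)

lemma prime_filterD:
  assumes "prime_filter F"
  shows prime_filter_top: "top \<in> F"
    and prime_filter_bot: "bot \<notin> F"
    and prime_filter_mono: "x \<in> F \<Longrightarrow> x \<le> y \<Longrightarrow> y \<in> F"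
    and prime_filter_inf: "inf x y \<in> F \<longleftrightarrow> x \<in> F \<and> y \<in> F"
    and prime_filter_sup: "sup x y \<in> F \<longleftrightarrow> x \<in> F \<or> y \<in> F"
proof -
  have F: "lattice_filter F" using assms unfolding prime_filter_def by blast
  show "top \<in> F" "inf x y \<in> F \<longleftrightarrow> x \<in> F \<and> y \<in> F"
    using F by (simp_all add: lattice_filterD)
  show up: "y \<in> F" if "x \<in> F" "x \<le> y" for x y
    using lattice_filter_mono[OF F that] .
  show "bot \<notin> F" using assms unfolding prime_filter_def by blast
  show "sup x y \<in> F \<longleftrightarrow> x \<in> F \<or> y \<in> F"
    using assms up[of x "sup x y"] up[of y "sup x y"] unfolding prime_filter_def by auto
qed

text \<open>The set is the filter generated by \<open>F\<close> and \<open>x\<close>. It drives the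
  maximality argument below and, later, the search for a prime filter above \<open>F\<close>
  containing \<open>x\<close>.\<close>

lemma lattice_filter_adjoin:
  assumes "lattice_filter F"
  shows "lattice_filter {z. \<exists>f\<in>F. inf f x \<le> z}"
  unfolding lattice_filter_def
proof (intro conjI ballI allI impI)
  show "top \<in> {z. \<exists>f\<in>F. inf f x \<le> z}" using lattice_filter_top[OF assms] by auto
next
  fix y z assume "y \<in> {z. \<exists>f\<in>F. inf f x \<le> z}" "y \<le> z"
  then show "z \<in> {z. \<exists>f\<in>F. inf f x \<le> z}" using order_trans by blast
next
  fix y z assume "y \<in> {z. \<exists>f\<in>F. inf f x \<le> z}" "z \<in> {z. \<exists>f\<in>F. inf f x \<le> z}"
  then obtain f f' where f: "f \<in> F" "f' \<in> F" "inf f x \<le> y" "inf f' x \<le> z" by blast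
  have "inf (inf f f') x \<le> inf y z"
    using f(3,4) by (meson inf_le1 inf_le2 le_inf_iff order_trans)
  moreover have "inf f f' \<in> F" using f lattice_filter_inf[OF assms] by blast
  ultimately show "inf y z \<in> {z. \<exists>f\<in>F. inf f x \<le> z}" by blast
qed

lemma subset_filter_adjoin: "F \<subseteq> {z. \<exists>f\<in>F. inf f x \<le> z}" for x :: "'a::lattice"
  using inf_le1 by blast

lemma mem_filter_adjoin: "lattice_filter F \<Longrightarrow> x \<in> {z. \<exists>f\<in>F. inf f x \<le> z}"
  using lattice_filter_top inf_le2 by blast

lemma prime_filter_exists:
  fixes K :: "'a::{distrib_lattice, bounded_lattice} set"
  assumes K: "lattice_filter K" and y: "y \<notin> K"
  obtains H where "prime_filter H" "K \<subseteq> H" "y \<notin> H"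
proof -
  let ?A = "{F. lattice_filter F \<and> K \<subseteq> F \<and> y \<notin> F}"
  have "\<exists>M\<in>?A. \<forall>X\<in>?A. M \<subseteq> X \<longrightarrow> X = M"
  proof (rule subset_Zorn_nonempty)
    show "?A \<noteq> {}" using K y by blast
    fix C assume ne: "C \<noteq> {}" and C: "subset.chain ?A C"
    have sub: "C \<subseteq> ?A" and lin: "\<And>X Y. X \<in> C \<Longrightarrow> Y \<in> C \<Longrightarrow> X \<subseteq> Y \<or> Y \<subseteq> X"
      using C unfolding subset_chain_def by blast+
    have "lattice_filter (\<Union>C)"
      unfolding lattice_filter_def
    proof (intro conjI ballI allI impI)
      show "top \<in> \<Union>C" using ne sub lattice_filter_top by blast
    next
      fix a b :: 'a assume "a \<in> \<Union>C" "a \<le> b"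
      then show "b \<in> \<Union>C" using sub lattice_filter_mono by blast
    next
      fix a b assume "a \<in> \<Union>C" "b \<in> \<Union>C"
      then obtain X where "X \<in> C" "a \<in> X" "b \<in> X" using lin by blast
      then show "inf a b \<in> \<Union>C" using sub lattice_filter_inf by blast
    qed
    then show "\<Union>C \<in> ?A" using ne sub by blast
  qed
  then obtain M where M: "lattice_filter M" "K \<subseteq> M" "y \<notin> M"
    and max: "\<And>X. lattice_filter X \<Longrightarrow> M \<subseteq> X \<Longrightarrow> y \<notin> X \<Longrightarrow> X = M" by auto
  \<comment> \<open>By maximality, adjoining any new element to \<open>M\<close> forces
    \<open>y\<close> into the generated filter.\<close>
  have below: "\<exists>f\<in>M. inf f a \<le> y" if "a \<notin> M" for a
    using max[OF lattice_filter_adjoin[OF M(1)] subset_filter_adjoin, of a]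
      mem_filter_adjoin[OF M(1), of a] that by blast
  have "a \<in> M \<or> b \<in> M" if ab: "sup a b \<in> M" for a b
  proof (rule ccontr)
    assume "\<not> (a \<in> M \<or> b \<in> M)"
    then obtain f f' where f: "f \<in> M" "f' \<in> M" "inf f a \<le> y" "inf f' b \<le> y"
      using below by blast
    let ?f = "inf f f'"
    have "inf ?f a \<le> y" "inf ?f b \<le> y"
      using f(3,4) by (meson inf_le1 inf_le2 le_inf_iff order_trans)+
    \<comment> \<open>Distributivity makes the maximal filter prime.\<close>
    then have "inf ?f (sup a b) \<le> y" by (simp add: inf_sup_distrib1)
    moreover have "inf ?f (sup a b) \<in> M" using f ab lattice_filter_inf[OF M(1)] by blast
    ultimately show False using M lattice_filter_mono by blast
  qed
  moreover have "bot \<notin> M" using M lattice_filter_mono bot_least by blast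
  ultimately show thesis using M that unfolding prime_filter_def by blast
qed

lemma prime_filter_separates:
  fixes x y :: "'a::{distrib_lattice, bounded_lattice}"
  assumes "\<not> x \<le> y"
  obtains F where "prime_filter F" "x \<in> F" "y \<notin> F"
proof -
  have "lattice_filter {z. x \<le> z}" unfolding lattice_filter_def by auto
  with assms obtain F where "prime_filter F" "{z. x \<le> z} \<subseteq> F" "y \<notin> F"
    using prime_filter_exists by (metis mem_Collect_eq)
  then show thesis using that by blast
qed

section \<open>Negation and pseudocomplement on prime filters\<close>

context pseudocomplemented_kleene_algebra
begin

lemma neg_inf: "neg (inf x y) = sup (neg x) (neg y)"
proof (rule antisym)
  have "neg (sup (neg x) (neg y)) \<le> x" "neg (sup (neg x) (neg y)) \<le> y"
    by (metis neg_antimono neg_neg sup_ge1, metis neg_antimono neg_neg sup_ge2)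
  then show "neg (inf x y) \<le> sup (neg x) (neg y)"
    by (metis le_inf_iff neg_antimono neg_neg)
qed (simp add: neg_antimono)

lemma neg_sup: "neg (sup x y) = inf (neg x) (neg y)"
  by (metis neg_inf neg_neg)

lemma neg_bot: "neg bot = top"
  by (metis bot_least neg_antimono neg_neg top_le)

lemma neg_top: "neg top = bot"
  by (metis neg_bot neg_neg)

definition dual :: "'a set \<Rightarrow> 'a set" where
  "dual F = {x. neg x \<notin> F}"

lemma mem_dual: "x \<in> dual F \<longleftrightarrow> neg x \<notin> F"
  by (simp add: dual_def)

lemma dual_dual: "dual (dual F) = F"
  by (simp add: dual_def neg_neg)

lemma dual_antimono: "F \<subseteq> G \<Longrightarrow> dual G \<subseteq> dual F"
  by (auto simp: dual_def)

text \<open>Negation reverses the lattice, so it carries prime filters to prime ideals;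
  \<open>dual F\<close> is the complement of such an ideal.\<close>

lemma prime_filter_dual:
  assumes F: "prime_filter F"
  shows "prime_filter (dual F)"
  unfolding prime_filter_def lattice_filter_def Ball_def mem_dual
  using prime_filterD[OF F] neg_antimono
  by (auto simp: neg_inf neg_sup neg_bot neg_top)

lemma dual_comparable:
  assumes F: "prime_filter F"
  shows "F \<subseteq> dual F \<or> dual F \<subseteq> F"
proof (rule ccontr)
  assume "\<not> ?thesis"
  then obtain x y where "x \<in> F" "neg x \<in> F" "neg y \<notin> F" "y \<notin> F"
    by (auto simp: dual_def)
  then show False
    \<comment> \<open>\<open>F\<close> contains \<open>inf x (neg x)\<close>, hence
      \<open>sup y (neg y)\<close>, but neither of its two joinands.\<close>
    using kleene[of x y] prime_filterD[OF F] by metis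
qed

definition low_filters :: "'a set set" where
  "low_filters = {F. prime_filter F \<and> F \<subseteq> dual F}"

lemma prime_filter_cases:
  assumes "prime_filter F"
  shows "F \<in> low_filters \<or> dual F \<in> low_filters"
  using dual_comparable[OF assms] assms prime_filter_dual[OF assms]
  by (auto simp: low_filters_def dual_dual)

lemma low_filters_separate:
  assumes "x \<noteq> y"
  obtains F where "F \<in> low_filters" "\<not> (x \<in> F \<longleftrightarrow> y \<in> F) \<or> \<not> (x \<in> dual F \<longleftrightarrow> y \<in> dual F)"
proof -
  obtain F where "prime_filter F" "\<not> (x \<in> F \<longleftrightarrow> y \<in> F)"
    using assms prime_filter_separates by (metis antisym)
  then show thesis
    using that[of F] that[of "dual F"] prime_filter_cases[of F] by (auto simp: dual_dual)
qed

text \<open>In any bounded distributive lattice with pseudocomplements, \<open>star x\<close> lies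
  in \<open>F\<close> iff no prime filter above \<open>F\<close> contains \<open>x\<close>. Testing
  only the filters \<open>dual G\<close> suffices because every prime filter lies below one of
  them.\<close>

lemma mem_star_iff:
  assumes F: "F \<in> low_filters"
  shows "star x \<in> F \<longleftrightarrow> (\<forall>G\<in>low_filters. F \<subseteq> dual G \<longrightarrow> x \<notin> dual G)"
proof (intro iffI ballI impI notI)
  fix G assume *: "star x \<in> F" "G \<in> low_filters" "F \<subseteq> dual G" "x \<in> dual G"
  then have "prime_filter (dual G)" by (simp add: low_filters_def prime_filter_dual)
  then show False
    using * inf_star[of x] prime_filter_inf prime_filter_bot by (metis subsetD)
next
  assume R: "\<forall>G\<in>low_filters. F \<subseteq> dual G \<longrightarrow> x \<notin> dual G"
  have pF: "prime_filter F" using F by (simp add: low_filters_def)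
  then have fF: "lattice_filter F" by (simp add: prime_filter_def)
  show "star x \<in> F"
  proof (rule ccontr)
    assume "star x \<notin> F"
    \<comment> \<open>Otherwise some \<open>f\<close> in \<open>F\<close> is disjoint from
      \<open>x\<close>, so it lies below \<open>star x\<close>.\<close>
    then have "bot \<notin> {z. \<exists>f\<in>F. inf f x \<le> z}"
      using star_greatest prime_filter_mono[OF pF] by (auto simp: bot_unique inf_commute)
    then obtain H where H: "prime_filter H" "{z. \<exists>f\<in>F. inf f x \<le> z} \<subseteq> H"
      by (rule prime_filter_exists[OF lattice_filter_adjoin[OF fF]])
    have "F \<subseteq> H" by (rule subset_trans[OF subset_filter_adjoin H(2)])
    moreover have "x \<in> H" by (rule subsetD[OF H(2) mem_filter_adjoin[OF fF]])
    moreover have "\<exists>G\<in>low_filters. H \<subseteq> dual G"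
      using prime_filter_cases[OF H(1)]
    proof
      assume "dual H \<in> low_filters"
      moreover have "H \<subseteq> dual (dual H)" by (simp add: dual_dual)
      ultimately show ?thesis by blast
    qed (auto simp: low_filters_def)
    ultimately show False using R by blast
  qed
qed

end

section \<open>Consequences of regularity\<close>

context regular_pseudocomplemented_kleene_algebra
begin

text \<open>The element \<open>?d\<close> is dense. Regularity identifies
  \<open>inf (neg ?d) ?d\<close> with \<open>neg ?d\<close>: meeting with a dense element does not
  change the pseudocomplement, and the negations of both are above \<open>?d\<close>, hence dense
  too.\<close>

lemma neg_dense_le: "neg (sup x (star x)) \<le> sup x (star x)"
proof -
  let ?d = "sup x (star x)"
  have dense: "y = bot" if "inf ?d y = bot" for y
  proof -
    have "inf x y = bot" "inf (star x) y = bot"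
      using that by (simp_all add: inf_sup_distrib2 sup_eq_bot_iff)
    then show ?thesis using star_greatest by (metis inf.absorb_iff2)
  qed
  have d: "star ?d = bot" using dense inf_star by blast
  have "star (inf (neg ?d) ?d) = star (neg ?d)"
  proof (rule antisym; rule star_greatest)
    show "inf (inf (neg ?d) ?d) (star (neg ?d)) = bot"
      by (metis inf_star inf_assoc inf_commute inf_bot_left)
    have "inf ?d (inf (neg ?d) (star (inf (neg ?d) ?d))) = bot"
      by (metis inf_star inf_assoc inf_commute)
    then show "inf (neg ?d) (star (inf (neg ?d) ?d)) = bot"
      by (rule dense)
  qed
  moreover have "star (neg (inf (neg ?d) ?d)) = star (neg (neg ?d))"
  proof -
    have "star (sup ?d (neg ?d)) = bot"
      using dense inf_star[of "sup ?d (neg ?d)"] by (metis inf_sup_distrib2 sup_eq_bot_iff)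
    then show ?thesis using d by (simp only: neg_inf neg_neg)
  qed
  ultimately have "inf (neg ?d) ?d = neg ?d" by (rule regular)
  then show ?thesis by (metis inf_le2)
qed

text \<open>For low \<open>F\<close> this makes \<open>dual F\<close> a maximal prime filter: a
  larger one would contain some \<open>x\<close> together with \<open>star x\<close>.\<close>

lemma star_mem_dual_iff:
  assumes "F \<in> low_filters"
  shows "star x \<in> dual F \<longleftrightarrow> x \<notin> dual F"
proof -
  have F: "prime_filter F" "F \<subseteq> dual F" and dF: "prime_filter (dual F)"
    using assms by (auto simp: low_filters_def prime_filter_dual)
  have "x \<notin> dual F \<or> star x \<notin> dual F"
    using inf_star[of x] prime_filter_inf[OF dF] prime_filter_bot[OF dF] by metis
  moreover have "x \<in> dual F \<or> star x \<in> dual F"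
  proof (rule ccontr)
    assume "\<not> ?thesis"
    then have "neg (sup x (star x)) \<in> F"
      by (simp add: mem_dual neg_sup prime_filter_inf[OF F(1)])
    then have "sup x (star x) \<in> dual F"
      using neg_dense_le prime_filter_mono[OF F(1)] F(2) by blast
    with \<open>\<not> ?thesis\<close> show False using prime_filter_sup[OF dF] by blast
  qed
  ultimately show ?thesis by blast
qed

end

section \<open>The covering\<close>

context pseudocomplemented_kleene_algebra
begin

lemma subset_dual_sym:
  assumes "F \<subseteq> dual G" shows "G \<subseteq> dual F"
  using dual_antimono[OF assms] by (simp add: dual_dual)

text \<open>When \<open>F \<noteq> dual F\<close>, the point \<open>{F, dual F}\<close> is a second point lying in the block of \<open>F\<close> only;
  without it a block could be a singleton although \<open>F \<noteq> dual F\<close>.\<close>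

definition points :: "'a set set set" where
  "points = {{F, G} |F G. F \<in> low_filters \<and> (G \<in> low_filters \<and> F \<subseteq> dual G \<or> G = dual F)}"

definition block :: "'a set \<Rightarrow> 'a set set set" where
  "block F = {p \<in> points. F \<in> p}"

definition blocks :: "'a set set set set" where
  "blocks = block ` low_filters"

abbreviation tol where "tol \<equiv> induced_tolerance blocks"

lemma singleton_point:
  assumes "F \<in> low_filters" shows "{F} \<in> points"
  using assms unfolding points_def low_filters_def by blast

lemma singleton_block:
  assumes "F \<in> low_filters" shows "{F} \<in> block G \<longleftrightarrow> G = F"
  using singleton_point[OF assms] by (auto simp: block_def)

lemma covering_blocks: "covering points blocks"
proof -
  have "block F \<noteq> {}" if "F \<in> low_filters" for F using singleton_block[OF that] by blast
  moreover have "\<exists>F\<in>low_filters. p \<in> block F" if "p \<in> points" for p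
    using that unfolding block_def points_def by blast
  ultimately show ?thesis unfolding covering_def blocks_def block_def by fast
qed

lemma irredundant_covering_blocks: "irredundant_covering points blocks"
  unfolding irredundant_covering_def
proof (intro conjI ballI notI)
  fix B assume "B \<in> blocks" and c: "covering points (blocks - {B})"
  then obtain F where F: "F \<in> low_filters" "B = block F" unfolding blocks_def by blast
  have "{F} \<in> \<Union>(blocks - {B})"
    using c singleton_point[OF F(1)] unfolding covering_def by blast
  then obtain G where "{F} \<in> block G" "block G \<noteq> B" unfolding blocks_def by blast
  then show False using F singleton_block[OF F(1)] by metis
qed (rule covering_blocks)

lemma tol_subset: "tol \<subseteq> points \<times> points"
  using induced_tolerance_subset[OF covering_blocks] .

lemma tol_iff: "(p, q) \<in> tol \<longleftrightarrow> (\<exists>F\<in>low_filters. p \<in> block F \<and> q \<in> block F)"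
  unfolding induced_tolerance_def blocks_def by blast

text \<open>The neighbourhood of a point is the union of the blocks through it, so both
  approximations can be computed block by block.\<close>

lemma lower_eq:
  "lower points tol X = {p \<in> points. \<forall>F\<in>low_filters. p \<in> block F \<longrightarrow> block F \<subseteq> X}"
  unfolding lower_def Image_singleton tol_iff by blast

lemma upper_eq:
  "upper points tol X = {p \<in> points. \<exists>F\<in>low_filters. p \<in> block F \<and> block F \<inter> X \<noteq> {}}"
  unfolding upper_def Image_singleton tol_iff by blast

definition lo :: "'a \<Rightarrow> 'a set set set" where
  "lo x = {p \<in> points. \<forall>F\<in>low_filters. p \<in> block F \<longrightarrow> x \<in> F}"

definition up :: "'a \<Rightarrow> 'a set set set" where
  "up x = {p \<in> points. \<exists>F\<in>low_filters. p \<in> block F \<and> x \<in> dual F}"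

text \<open>Since \<open>{F}\<close> lies in one block only, it serves as a test point that reads
  off membership in \<open>F\<close>, and in \<open>dual F\<close> for \<open>up\<close>.\<close>

lemma singleton_lo:
  assumes "F \<in> low_filters" shows "{F} \<in> lo x \<longleftrightarrow> x \<in> F"
  using singleton_point[OF assms] singleton_block[OF assms] assms by (auto simp: lo_def)

lemma singleton_up:
  assumes "F \<in> low_filters" shows "{F} \<in> up x \<longleftrightarrow> x \<in> dual F"
  using singleton_point[OF assms] singleton_block[OF assms] assms by (auto simp: up_def)

lemma lo_inter_block:
  assumes F: "F \<in> low_filters" shows "block F \<inter> lo x \<noteq> {} \<longleftrightarrow> x \<in> F"
  using singleton_lo[OF F] singleton_block[OF F] F unfolding lo_def by blast

lemma block_subset_up:
  assumes F: "F \<in> low_filters" shows "block F \<subseteq> up x \<longleftrightarrow> x \<in> dual F"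
  using singleton_up[OF F] singleton_block[OF F] F unfolding up_def block_def by blast

lemma meeting_blocks:
  assumes F: "F \<in> low_filters" and G: "G \<in> low_filters"
  shows "block F \<inter> block G \<noteq> {} \<longleftrightarrow> F \<subseteq> dual G"
proof
  assume "F \<subseteq> dual G"
  then have "{F, G} \<in> points" using F G unfolding points_def by blast
  then show "block F \<inter> block G \<noteq> {}" unfolding block_def by blast
next
  assume "block F \<inter> block G \<noteq> {}"
  then obtain p where p: "p \<in> points" "F \<in> p" "G \<in> p"
    unfolding block_def by blast
  from p(1) obtain F' G' where "p = {F', G'}" and *: "F' \<in> low_filters"
      "G' \<in> low_filters \<and> F' \<subseteq> dual G' \<or> G' = dual F'"
    unfolding points_def by blast
  with p have FG: "F \<in> {F', G'}" "G \<in> {F', G'}" by simp_all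
  have refl: "F \<subseteq> dual F" using F by (simp add: low_filters_def)
  show "F \<subseteq> dual G"
  proof (cases "F = G")
    case False
    from *(2) show ?thesis
    proof
      assume "G' \<in> low_filters \<and> F' \<subseteq> dual G'"
      then show ?thesis using False FG subset_dual_sym[of F' G'] by auto
    next
      \<comment> \<open>The extra points create no unwanted intersections: if two distinct low
        filters share one, each is the dual of the other.\<close>
      assume G': "G' = dual F'"
      then have "F = dual G" using False FG by (auto simp: dual_dual)
      then show ?thesis by simp
    qed
  qed (use refl in simp)
qed

lemma rough_set_representative:
  obtains X where "X \<subseteq> points" "rough_set points tol X = (lo x, up x)"
proof
  \<comment> \<open>Whole blocks are taken where \<open>x\<close> is in \<open>F\<close>; where
    \<open>x\<close> is only in \<open>dual F\<close>, the single point \<open>{F}\<close> makes the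
    block meet \<open>?X\<close> without being filled.\<close>
  let ?X = "{p. \<exists>F\<in>low_filters. p \<in> block F \<and> x \<in> F \<or> p = {F} \<and> F \<in> low_filters \<and> x \<in> dual F}"
  show "?X \<subseteq> points" using singleton_point by (auto simp: block_def)
  have A: "block F \<subseteq> ?X \<longleftrightarrow> x \<in> F" if F: "F \<in> low_filters" for F
  proof
    assume sub: "block F \<subseteq> ?X"
    \<comment> \<open>The point \<open>{F}\<close> cannot be the test here, as it may be in
      \<open>?X\<close> merely because \<open>x\<close> is in \<open>dual F\<close>. The only low
      filter in \<open>?p\<close> is \<open>F\<close>.\<close>
    let ?p = "{F, dual F}"
    have p: "?p \<in> block F" using F unfolding block_def points_def by blast
    have uniq: "G = F" if G: "G \<in> low_filters" "G \<in> ?p" for G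
    proof -
      have "dual F = F" if "dual F \<in> low_filters"
        using that F by (auto simp: low_filters_def dual_dual)
      then show ?thesis using G by auto
    qed
    from sub p have "?p \<in> ?X" by blast
    then consider G where "G \<in> low_filters" "?p \<in> block G" "x \<in> G"
      | G where "?p = {G}" "x \<in> dual G" by blast
    then show "x \<in> F"
    proof cases
      case 1
      then show ?thesis using uniq by (auto simp: block_def)
    next
      case 2
      \<comment> \<open>If \<open>?p\<close> is a singleton, then \<open>F\<close>,
        \<open>dual F\<close> and \<open>G\<close> coincide.\<close>
      then show ?thesis by (metis insertI1 insertI2 singletonD)
    qed
  qed (use F in blast)
  have C: "block F \<inter> ?X \<noteq> {} \<longleftrightarrow> x \<in> dual F" if F: "F \<in> low_filters" for F
  proof
    assume "block F \<inter> ?X \<noteq> {}"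
    then consider G where "G \<in> low_filters" "block F \<inter> block G \<noteq> {}" "x \<in> G"
      | G where "{G} \<in> block F" "G \<in> low_filters" "x \<in> dual G" by blast
    then show "x \<in> dual F"
    proof cases
      case 1
      \<comment> \<open>Blocks that meet give \<open>G\<close> contained in \<open>dual F\<close>,
        so filling the block of \<open>G\<close> adds nothing unwanted to the upper
        approximation.\<close>
      then show ?thesis using meeting_blocks[OF F] subset_dual_sym by blast
    next
      case 2
      then show ?thesis using singleton_block by metis
    qed
  next
    assume "x \<in> dual F"
    then show "block F \<inter> ?X \<noteq> {}" using F singleton_block[OF F] by blast
  qed
  show "rough_set points tol ?X = (lo x, up x)"
    unfolding rough_set_def lower_eq upper_eq lo_def up_def
    using A C by (intro arg_cong2[where f = Pair] Collect_cong conj_cong refl) auto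
qed

section \<open>The operations on the pairs \<open>(lo x, up x)\<close>\<close>

lemma rs_join_lo_up:
  "rs_join points tol (lo x, up x) (lo y, up y) = (lo (sup x y), up (sup x y))"
proof -
  have "block F \<subseteq> upper points tol (lo x \<union> lo y) \<longleftrightarrow> sup x y \<in> F" if F: "F \<in> low_filters" for F
  proof -
    \<comment> \<open>From left to right, evaluate at \<open>{F}\<close>, whose only block is that
      of \<open>F\<close>. The meet is treated dually.\<close>
    have "block F \<subseteq> upper points tol (lo x \<union> lo y) \<longleftrightarrow> block F \<inter> (lo x \<union> lo y) \<noteq> {}"
      unfolding upper_eq using F singleton_block[OF F] by (auto simp: block_def)
    also have "\<dots> \<longleftrightarrow> x \<in> F \<or> y \<in> F" using lo_inter_block[OF F] by blast
    finally show ?thesis using F prime_filter_sup unfolding low_filters_def by blast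
  qed
  then have "lower points tol (upper points tol (lo x \<union> lo y)) = lo (sup x y)"
    unfolding lower_eq[of "upper _ _ _"] lo_def[of "sup x y"] by blast
  moreover have "sup x y \<in> dual F \<longleftrightarrow> x \<in> dual F \<or> y \<in> dual F" if "F \<in> low_filters" for F
    using that prime_filter_sup prime_filter_dual unfolding low_filters_def by blast
  then have "up x \<union> up y = up (sup x y)" unfolding up_def by blast
  ultimately show ?thesis by (simp add: rs_join_def)
qed

lemma rs_meet_lo_up:
  "rs_meet points tol (lo x, up x) (lo y, up y) = (lo (inf x y), up (inf x y))"
proof -
  have "block F \<inter> lower points tol (up x \<inter> up y) \<noteq> {} \<longleftrightarrow> inf x y \<in> dual F"
    if F: "F \<in> low_filters" for F
  proof -
    have "block F \<inter> lower points tol (up x \<inter> up y) \<noteq> {} \<longleftrightarrow> block F \<subseteq> up x \<inter> up y"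
    proof
      assume "block F \<subseteq> up x \<inter> up y"
      then have "{F} \<in> lower points tol (up x \<inter> up y)"
        by (simp add: lower_eq singleton_point[OF F] singleton_block[OF F])
      then show "block F \<inter> lower points tol (up x \<inter> up y) \<noteq> {}"
        using singleton_block[OF F] by blast
    qed (use F in \<open>auto simp: lower_eq\<close>)
    also have "\<dots> \<longleftrightarrow> x \<in> dual F \<and> y \<in> dual F" using block_subset_up[OF F] by simp
    finally show ?thesis
      using F prime_filter_inf prime_filter_dual unfolding low_filters_def by blast
  qed
  then have "upper points tol (lower points tol (up x \<inter> up y)) = up (inf x y)"
    unfolding upper_eq[of "lower _ _ _"] up_def[of "inf x y"] by blast
  moreover have "inf x y \<in> F \<longleftrightarrow> x \<in> F \<and> y \<in> F" if "F \<in> low_filters" for F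
    using that prime_filter_inf unfolding low_filters_def by blast
  then have "lo x \<inter> lo y = lo (inf x y)" unfolding lo_def by blast
  ultimately show ?thesis by (simp add: rs_meet_def)
qed

lemma lo_neg: "lo (neg x) = points - up x"
  by (auto simp: lo_def up_def mem_dual)

lemma up_neg: "up (neg x) = points - lo x"
  by (auto simp: lo_def up_def mem_dual neg_neg)

lemma rs_neg_lo_up: "rs_neg points tol (lo x, up x) = (lo (neg x), up (neg x))"
proof -
  obtain X where X: "X \<subseteq> points" "rough_set points tol X = (lo x, up x)"
    by (rule rough_set_representative)
  then show ?thesis
    using rs_neg_rough_set[OF tol_subset X(1)]
    by (simp add: lower_compl[OF tol_subset] upper_compl[OF tol_subset] rough_set_def lo_neg up_neg)
qed

lemma lo_up_bot: "(lo bot, up bot) = ({}, {})"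
proof -
  have "bot \<notin> F" "bot \<notin> dual F" if "F \<in> low_filters" for F
    using that prime_filter_bot prime_filter_dual unfolding low_filters_def by blast+
  moreover have "\<exists>F\<in>low_filters. p \<in> block F" if "p \<in> points" for p
    using that covering_blocks unfolding covering_def blocks_def by blast
  ultimately show ?thesis unfolding lo_def up_def by blast
qed

lemma lo_up_top: "(lo top, up top) = (points, points)"
  using lo_up_bot lo_neg[of bot] up_neg[of bot] by (simp add: neg_bot)

text \<open>The points \<open>{F}\<close> recover membership in \<open>F\<close> and
  \<open>dual F\<close>, and these filters separate elements.\<close>

lemma inj_lo_up: "inj (\<lambda>x. (lo x, up x))"
proof (rule injI, rule ccontr)
  fix x y assume eq: "(lo x, up x) = (lo y, up y)" and "x \<noteq> y"
  then obtain F where "F \<in> low_filters"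
      "\<not> (x \<in> F \<longleftrightarrow> y \<in> F) \<or> \<not> (x \<in> dual F \<longleftrightarrow> y \<in> dual F)"
    using low_filters_separate by blast
  then show False using eq singleton_lo singleton_up by (metis prod.inject)
qed

end

context regular_pseudocomplemented_kleene_algebra
begin

lemma rs_star_lo_up: "rs_star points tol (lo x, up x) = (lo (star x), up (star x))"
proof -
  obtain X where X: "X \<subseteq> points" "rough_set points tol X = (lo x, up x)"
    by (rule rough_set_representative)
  let ?Y = "points - up x"
  have Y: "lower points tol (points - X) = ?Y"
    using X(2) by (simp add: lower_compl[OF tol_subset] rough_set_def)
  have "block F \<subseteq> ?Y \<longleftrightarrow> star x \<in> F" if F: "F \<in> low_filters" for F
  proof -
    \<comment> \<open>The blocks meeting that of \<open>F\<close> belong to exactly the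
      \<open>G\<close> quantified over in \<open>mem_star_iff\<close>.\<close>
    have "block F \<subseteq> ?Y \<longleftrightarrow> (\<forall>G\<in>low_filters. block F \<inter> block G \<noteq> {} \<longrightarrow> x \<notin> dual G)"
      unfolding up_def block_def by blast
    then show ?thesis using mem_star_iff[OF F] meeting_blocks[OF F] by simp
  qed
  then have "lower points tol ?Y = lo (star x)" unfolding lower_eq lo_def by blast
  moreover have "block F \<inter> ?Y \<noteq> {} \<longleftrightarrow> star x \<in> dual F" if F: "F \<in> low_filters" for F
    \<comment> \<open>Because \<open>?Y\<close> is \<open>lo (neg x)\<close>, the block of
      \<open>F\<close> meets it iff \<open>x\<close> is not in \<open>dual F\<close>; regularity
      turns this into membership of \<open>star x\<close>.\<close>
    using lo_inter_block[OF F, of "neg x"] star_mem_dual_iff[OF F, of x]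
    by (simp add: lo_neg mem_dual)
  then have "upper points tol ?Y = up (star x)"
    unfolding upper_eq up_def[of "star x"] by blast
  ultimately show ?thesis using rs_star_rough_set[OF tol_subset X(1)] X(2) Y by simp
qed

end

theorem theorem3p7:
  fixes neg star :: "'a::{distrib_lattice, bounded_lattice} \<Rightarrow> 'a"
  assumes "regular_pseudocomplemented_kleene_algebra neg star"
  shows "\<exists>(U :: 'a set set set) R.
    (\<exists>H. irredundant_covering U H \<and> R = induced_tolerance H) \<and>
    (\<exists>S h. rs_subalgebra U R S \<and> rs_isomorphism neg star U R S h)"
proof -
  interpret regular_pseudocomplemented_kleene_algebra neg star by (rule assms)
  let ?h = "\<lambda>x. (lo x, up x)"
  have "range ?h \<subseteq> RS points tol"
  proof
    fix p assume "p \<in> range ?h"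
    then obtain x where x: "p = ?h x" by blast
    obtain X where "X \<subseteq> points" "rough_set points tol X = ?h x"
      by (rule rough_set_representative)
    then show "p \<in> RS points tol" unfolding RS_def x by (intro image_eqI[of _ _ X]) auto
  qed
  moreover have "({}, {}) \<in> range ?h" "(points, points) \<in> range ?h"
    by (rule range_eqI, rule lo_up_bot[symmetric]) (rule range_eqI, rule lo_up_top[symmetric])
  \<comment> \<open>Closure of the range is immediate once \<open>?h\<close> commutes with all
    operations.\<close>
  ultimately have "rs_subalgebra points tol (range ?h)"
    unfolding rs_subalgebra_def
    by (auto simp: rs_join_lo_up rs_meet_lo_up rs_neg_lo_up rs_star_lo_up)
  moreover have "rs_isomorphism neg star points tol (range ?h) ?h"
    unfolding rs_isomorphism_def
    using inj_lo_up lo_up_bot lo_up_top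
    by (simp add: inj_on_imp_bij_betw rs_join_lo_up rs_meet_lo_up rs_neg_lo_up rs_star_lo_up)
  ultimately show ?thesis using irredundant_covering_blocks by blast
qed

end
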